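(* Let $(X,d)$ be a metric space and $T:X\to\mathcal{CB}(X)$. Suppose there exist a metric-preserving function $f:[0,\infty)\to[0,\infty)$ and $k\in(0,1)$ such that for all $x,y\in X$, $f(H(Tx,Ty))\le k\,d(x,y)$. Suppose further that $c\in(0,1)$ is such that $kt\le f(ct)$ for all sufficiently small $t>0$. Then for all sufficiently small $\varepsilon>0$, $T$ is an $(\varepsilon,c)$-uniform local multivalued contraction on $(X,d)$.
   Context: A function $f:[0,\infty)\to[0,\infty)$ is metric-preserving if for every metric space $(Y,\rho)$, the composition $f\circ\rho$ is a metric on $Y$. $\mathcal{CB}(X)$ is the family of nonempty, closed and bounded subsets of $X$, with Hausdorff distance $H(A,B)=\max\{\sup_{x\in A}d(x,B),\sup_{x\in B}d(x,A)\}$, where $d(x,B)=\inf_{y\in B}d(x,y)$. For $\varepsilon>0$ and $c\in(0,1)$, $T:X\to\mathcal{CB}(X)$ is an $(\varepsilon,c)$-uniform local multivalued contraction if for all $x,y\in X$, $d(x,y)<\varepsilon$ implies $H(Tx,Ty)\le c\,d(x,y)$. *)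

theory Defs
  imports "HOL-Analysis.Analysis"
begin

text \<open>
  A function on \<open>[0,\<infinity>)\<close> is a total function on \<open>real\<close>; its values at negative arguments are never used.
  A definition cannot quantify over types, so the metric spaces ranged over here are those whose
  carrier is a set of reals, with an arbitrary metric, unrelated to the usual one.
  By \<open>metric_preserving_Metric_space\<close> below this is no restriction: the metric axioms involve at most three
  points at a time, so the composition is a metric for every metric space on any type.
\<close>

definition metric_preserving :: "(real \<Rightarrow> real) \<Rightarrow> bool" where
  "metric_preserving f \<longleftrightarrow>
     f \<in> {0..} \<rightarrow> {0..} \<and>
     (\<forall>(Y :: real set) \<rho>. Metric_space Y \<rho> \<longrightarrow> Metric_space Y (\<lambda>x y. f (\<rho> x y)))"

lemma metric_preserving_Metric_space:
  fixes M :: "'a set"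
  assumes f: "metric_preserving f" and M: "Metric_space M d"
  shows "Metric_space M (\<lambda>x y. f (d x y))"
proof -
  interpret Metric_space M d by (rule M)
  have transfer: "Metric_space F (\<lambda>x y. f (d x y))" if F: "finite F" "F \<subseteq> M" for F
  proof -
    obtain e :: "'a \<Rightarrow> nat" where e: "inj_on e F"
      using F(1) finite_imp_inj_to_nat_seg by blast
    define e' where "e' x = real (e x)" for x
    define g where "g = inv_into F e'"
    have inj: "inj_on e' F"
      using e by (simp add: inj_on_def e'_def)
    have ge: "g (e' x) = x" if "x \<in> F" for x
      using that inj by (simp add: g_def)
    have "Metric_space (e' ` F) (\<lambda>u v. d (g u) (g v))"
      using F(2) by unfold_locales (auto simp: ge commute subset_iff intro: triangle)
    then have "Metric_space (e' ` F) (\<lambda>u v. f (d (g u) (g v)))"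
      using f by (simp add: metric_preserving_def)
    then interpret F: Metric_space "e' ` F" "\<lambda>u v. f (d (g u) (g v))" .
    show ?thesis
    proof
      show "0 \<le> f (d x y)" for x y
        using f by (auto simp: metric_preserving_def)
      show "f (d x y) = f (d y x)" for x y
        by (simp add: commute)
      show "f (d x y) = 0 \<longleftrightarrow> x = y" if "x \<in> F" "y \<in> F" for x y
        using that F.zero[of "e' x" "e' y"] inj by (simp add: ge inj_on_eq_iff)
      show "f (d x z) \<le> f (d x y) + f (d y z)" if "x \<in> F" "y \<in> F" "z \<in> F" for x y z
        using that F.triangle[of "e' x" "e' y" "e' z"] by (simp add: ge)
    qed
  qed
  show ?thesis
  proof
    show "0 \<le> f (d x y)" for x y
      using f by (auto simp: metric_preserving_def)
    show "f (d x y) = f (d y x)" for x y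
      by (simp add: commute)
    show "f (d x y) = 0 \<longleftrightarrow> x = y" if "x \<in> M" "y \<in> M" for x y
      using Metric_space.zero[OF transfer[of "{x, y}"], of x y] that by simp
    show "f (d x z) \<le> f (d x y) + f (d y z)" if "x \<in> M" "y \<in> M" "z \<in> M" for x y z
      using Metric_space.triangle[OF transfer[of "{x, y, z}"], of x y z] that by simp
  qed
qed

definition closed_bounded_sets :: "'a::metric_space set set" where
  "closed_bounded_sets = {A. A \<noteq> {} \<and> closed A \<and> bounded A}"

definition Hausdorff_dist :: "'a::metric_space set \<Rightarrow> 'a set \<Rightarrow> real" where
  "Hausdorff_dist A B = max (SUP x\<in>A. infdist x B) (SUP x\<in>B. infdist x A)"

definition uniform_local_multivalued_contraction ::
    "real \<Rightarrow> real \<Rightarrow> ('a::metric_space \<Rightarrow> 'a set) \<Rightarrow> bool" where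
  "uniform_local_multivalued_contraction \<epsilon> c T \<longleftrightarrow>
     0 < \<epsilon> \<and> c \<in> {0<..<1} \<and> T \<in> UNIV \<rightarrow> closed_bounded_sets \<and>
     (\<forall>x y. dist x y < \<epsilon> \<longrightarrow> Hausdorff_dist (T x) (T y) \<le> c * dist x y)"

end

theory Submission
  imports Defs
begin

text \<open>
  Substituting \<open>h = c t\<close>, the hypothesis on \<open>c\<close> says that \<open>f h \<ge> (k / c) h\<close> for small \<open>h > 0\<close>, so
  \<open>f H \<le> k d\<close> gives \<open>H \<le> c d\<close> as soon as \<open>H\<close> is small. A metric-preserving function need not be
  monotone, but applying it to isosceles triangles shows that \<open>f a \<le> 2 f b\<close> for \<open>a \<le> 2 b\<close>; hence
  \<open>f\<close> is bounded away from 0 outside each neighbourhood of 0, and \<open>H\<close> is small when \<open>f H\<close> is.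
\<close>

lemma metric_preserving_nonneg: "metric_preserving f \<Longrightarrow> 0 \<le> x \<Longrightarrow> 0 \<le> f x"
  by (auto simp: metric_preserving_def)

lemma metric_preserving_isosceles:
  assumes f: "metric_preserving f" and "0 < a" "a \<le> 2 * b"
  shows "0 < f a" "f a \<le> 2 * f b"
proof -
  \<comment> \<open>The isosceles triangle on the points 0, 1, 2: apex 1, legs \<open>b\<close>,
    base \<open>a\<close>.\<close>
  define \<rho> :: "real \<Rightarrow> real \<Rightarrow> real" where
    "\<rho> x y = (if x = y then 0 else if x = 1 \<or> y = 1 then b else a)" for x y
  have "Metric_space {0, 1, 2} \<rho>"
    using assms(2,3) by unfold_locales (auto simp: \<rho>_def)
  then interpret F: Metric_space "{0, 1, 2}" "\<lambda>x y. f (\<rho> x y)"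
    by (rule metric_preserving_Metric_space[OF f])
  show "f a \<le> 2 * f b"
    using F.triangle[of 0 1 2] by (simp add: \<rho>_def)
  have "f a \<noteq> 0"
    using F.zero[of 0 2] by (simp add: \<rho>_def)
  with metric_preserving_nonneg[OF f, of a] \<open>0 < a\<close> show "0 < f a"
    by simp
qed

theorem corollary31:
  fixes T :: "'a::metric_space \<Rightarrow> 'a set" and f :: "real \<Rightarrow> real" and k c :: real
  assumes "T \<in> UNIV \<rightarrow> closed_bounded_sets"
    and "metric_preserving f"
    and "k \<in> {0<..<1}"
    and "\<And>x y. f (Hausdorff_dist (T x) (T y)) \<le> k * dist x y"
    and "c \<in> {0<..<1}"
    and "\<forall>\<^sub>F t in at_right 0. k * t \<le> f (c * t)"
  shows "\<forall>\<^sub>F \<epsilon> in at_right 0. uniform_local_multivalued_contraction \<epsilon> c T"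
proof -
  have k: "0 < k" and c: "0 < c"
    using assms(3,5) by auto
  obtain \<delta> where \<delta>: "0 < \<delta>" "\<And>t. 0 < t \<Longrightarrow> t < \<delta> \<Longrightarrow> k * t \<le> f (c * t)"
    using assms(6) by (auto simp: eventually_at_right_field)
  \<comment> \<open>Chosen so that \<open>dist x y < \<epsilon>0\<close> forces
    \<open>f h < f (c * \<delta>) / 2\<close> for the Hausdorff distance \<open>h\<close> of the
    images.\<close>
  define \<epsilon>0 where "\<epsilon>0 = f (c * \<delta>) / (2 * k)"
  have "0 < \<epsilon>0"
    using metric_preserving_isosceles(1)[OF assms(2), of "c * \<delta>" "c * \<delta>"] \<delta>(1) c k
    by (simp add: \<epsilon>0_def)
  moreover have "uniform_local_multivalued_contraction \<epsilon> c T" if \<epsilon>: "0 < \<epsilon>" "\<epsilon> < \<epsilon>0" for \<epsilon>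
    unfolding uniform_local_multivalued_contraction_def
  proof (intro conjI allI impI)
    fix x y :: 'a assume xy: "dist x y < \<epsilon>"
    define h where "h = Hausdorff_dist (T x) (T y)"
    have fh: "f h \<le> k * dist x y"
      using assms(4) by (simp add: h_def)
    have "k * dist x y < k * \<epsilon>0"
      using xy \<epsilon>(2) k by (intro mult_strict_left_mono) auto
    with fh have "2 * f h < f (c * \<delta>)"
      using k by (simp add: \<epsilon>0_def)
    \<comment> \<open>Otherwise \<open>c * \<delta> \<le> 2 * h\<close>, and the isosceles bound
      would give \<open>f (c * \<delta>) \<le> 2 * f h\<close>.\<close>
    then have "h < c * \<delta>"
      using metric_preserving_isosceles(2)[OF assms(2), of "c * \<delta>" h] \<delta>(1) c
      by (smt (verit) mult_pos_pos)
    have "h \<le> c * dist x y"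
    proof (cases "0 < h")
      case True
      \<comment> \<open>Here \<open>t = h / c\<close>, which lies below \<open>\<delta>\<close>
        since \<open>h < c * \<delta>\<close>.\<close>
      then have "k * (h / c) \<le> f (c * (h / c))"
        using \<open>h < c * \<delta>\<close> c by (intro \<delta>(2)) (auto simp: field_simps)
      also have "\<dots> \<le> k * dist x y"
        using fh c by simp
      finally show ?thesis
        using k c by (simp add: field_simps)
    next
      \<comment> \<open>The hypothesis on \<open>c\<close> concerns only \<open>t > 0\<close>; for
        \<open>h \<le> 0\<close> the bound holds because \<open>c * dist x y\<close> is
        nonnegative.\<close>
      case False
      with c show ?thesis
        by (smt (verit) mult_nonneg_nonneg zero_le_dist)
    qed
    then show "Hausdorff_dist (T x) (T y) \<le> c * dist x y"
      by (simp add: h_def)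
  qed (use assms \<epsilon> in auto)
  ultimately show ?thesis
    by (auto simp: eventually_at_right_field)
qed

end
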